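(* Let $n,c_{in},c_{out}\ge1$. For $1\le i\le c_{in}$ and $1\le j\le c_{out}$ let $f_{i,j}:\mathbb{R}^2\to\mathbb{C}$ be a trigonometric polynomial $$f_{i,j}(\omega_1,\omega_2)=\sum_{h_1=-n+1}^{n-1}\sum_{h_2=-n+1}^{n-1}d^{(i,j)}_{h_1,h_2}\,e^{\mathbf{i}(h_1\omega_1+h_2\omega_2)}$$ with real coefficients $d^{(i,j)}_{h_1,h_2}$. Let $M\in\mathbb{R}^{c_{in}n^2\times c_{out}n^2}$ be the block matrix whose $(i,j)$ block is the doubly-block Toeplitz matrix $D(f_{i,j})\in\mathbb{R}^{n^2\times n^2}$. Then the largest singular value of $M$ satisfies $$\sigma_1(M)\le\sqrt{\sum_{j=1}^{c_{out}}\ \sup_{(\omega_1,\omega_2)\in[0,2\pi]^2}\ \sum_{i=1}^{c_{in}}\left|f_{i,j}(\omega_1,\omega_2)\right|^2}.$$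
   Context: For $f:\mathbb{R}^2\to\mathbb{C}$ continuous and $2\pi$-periodic in each variable, $D(f)$ is the $n^2\times n^2$ block matrix $\big(D_{i,j}(f)\big)_{0\le i,j\le n-1}$ whose block $D_{i,j}(f)$ is the $n\times n$ matrix $$D_{i,j}(f)=\left(\frac{1}{4\pi^2}\int_0^{2\pi}\!\!\int_0^{2\pi}e^{-\mathbf{i}((i-j)\omega_1+(k-l)\omega_2)}f(\omega_1,\omega_2)\,d\omega_1\,d\omega_2\right)_{0\le k,l\le n-1}.$$ Here $\mathbf{i}$ in exponents is the imaginary unit. $\sigma_1$ denotes the largest singular value. *)

theory Defs
  imports "HOL-Analysis.Henstock_Kurzweil_Integration"
    "Jordan_Normal_Form.Schur_Decomposition"
    "Jordan_Normal_Form.Spectral_Radius"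
begin

text \<open>The \<open>p \<times> q\<close> block matrix with blocks \<open>B i j\<close> of size \<open>a \<times> b\<close>; blocks and entries
  are numbered from \<open>0\<close>.\<close>

definition block_mat :: "nat \<Rightarrow> nat \<Rightarrow> nat \<Rightarrow> nat \<Rightarrow> (nat \<Rightarrow> nat \<Rightarrow> 'a mat) \<Rightarrow> 'a mat" where
  "block_mat p q a b B =
     Matrix.mat (p * a) (q * b) (\<lambda>(r, s). B (r div a) (s div b) $$ (r mod a, s mod b))"

definition fourier_coeff :: "(real \<Rightarrow> real \<Rightarrow> complex) \<Rightarrow> int \<Rightarrow> int \<Rightarrow> complex" where
  "fourier_coeff f h1 h2 =
     1 / (4 * of_real pi ^ 2) *
     integral {0..2 * pi} (\<lambda>\<omega>2. integral {0..2 * pi} (\<lambda>\<omega>1.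
       exp (- (\<i> * of_real (of_int h1 * \<omega>1 + of_int h2 * \<omega>2))) * f \<omega>1 \<omega>2))"

definition toeplitz_block ::
    "nat \<Rightarrow> (real \<Rightarrow> real \<Rightarrow> complex) \<Rightarrow> nat \<Rightarrow> nat \<Rightarrow> complex mat" where
  "toeplitz_block n f i j =
     Matrix.mat n n (\<lambda>(k, l). fourier_coeff f (int i - int j) (int k - int l))"

definition doubly_block_toeplitz :: "nat \<Rightarrow> (real \<Rightarrow> real \<Rightarrow> complex) \<Rightarrow> complex mat" where
  "doubly_block_toeplitz n f = block_mat n n n n (toeplitz_block n f)"

text \<open>Singular values are the square roots of the eigenvalues of \<open>A\<^sup>* A\<close>. For a matrix with more
  columns than rows this adds at most the value \<open>0\<close> to those obtained from \<open>A A\<^sup>*\<close>, which does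
  not affect the largest one.\<close>

definition singular_values :: "complex mat \<Rightarrow> real set" where
  "singular_values A = {s. 0 \<le> s \<and> eigenvalue (mat_adjoint A * A) (of_real (s ^ 2))}"

definition largest_singular_value :: "complex mat \<Rightarrow> real" where
  "largest_singular_value A = Max (singular_values A)"

text \<open>The maximum is taken over a finite set, nonempty as soon as \<open>A\<close> has a column.\<close>

lemma finite_singular_values: "finite (singular_values A)"
proof -
  let ?B = "mat_adjoint A * A"
  have B: "?B \<in> carrier_mat (dim_col A) (dim_col A)"
    unfolding mat_adjoint_def by auto
  have "(\<lambda>s. of_real (s ^ 2)) ` singular_values A \<subseteq> spectrum ?B"
    unfolding singular_values_def spectrum_def by auto
  moreover have "finite (spectrum ?B)"
    using card_finite_spectrum[OF B] by simp
  ultimately have "finite ((\<lambda>s. complex_of_real (s ^ 2)) ` singular_values A)"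
    by (rule finite_subset)
  moreover have "inj_on (\<lambda>s. complex_of_real (s ^ 2)) (singular_values A)"
    unfolding inj_on_def singular_values_def by (auto simp flip: of_real_power)
  ultimately show ?thesis by (rule finite_imageD)
qed

lemma singular_values_nonempty:
  assumes "0 < dim_col A"
  shows "singular_values A \<noteq> {}"
proof -
  define m n where "m = dim_row A" and "n = dim_col A"
  have A: "A \<in> carrier_mat m n" by (auto simp: m_def n_def)
  have A': "mat_adjoint A \<in> carrier_mat n m"
    unfolding mat_adjoint_def m_def n_def by auto
  have A'_index: "mat_adjoint A $$ (i, j) = cnj (A $$ (j, i))" if "i < n" "j < m" for i j
    using that unfolding mat_adjoint_def m_def n_def
    by (simp add: mat_of_rows_def conjugate_vec_def)
  have B: "mat_adjoint A * A \<in> carrier_mat n n" using A A' by auto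
  from spectrum_non_empty[OF B] assms obtain k where k: "eigenvalue (mat_adjoint A * A) k"
    unfolding spectrum_def n_def by auto
  then obtain v where v: "v \<in> carrier_vec n" "v \<noteq> 0\<^sub>v n" "(mat_adjoint A * A) *\<^sub>v v = k \<cdot>\<^sub>v v"
    using B unfolding eigenvalue_def eigenvector_def by auto
  define w where "w = A *\<^sub>v v"
  have w: "w \<in> carrier_vec m" using A v by (auto simp: w_def)
  have sq: "x \<bullet>c x = of_real (\<Sum>i<dim_vec x. (cmod (vec_index x i))\<^sup>2)" for x :: "complex vec"
    by (simp add: scalar_prod_def lessThan_atLeast0 complex_norm_square del: of_real_power)
  have w_index: "vec_index w j = (\<Sum>i<n. A $$ (j, i) * vec_index v i)" if "j < m" for j
    using that A v unfolding w_def by (simp add: scalar_prod_def lessThan_atLeast0)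
  have "k * (v \<bullet>c v) = ((mat_adjoint A * A) *\<^sub>v v) \<bullet>c v"
    using v by simp
  also have "\<dots> = (mat_adjoint A *\<^sub>v w) \<bullet>c v"
    using A A' v unfolding w_def by (simp add: assoc_mult_mat_vec)
  also have "\<dots> = (\<Sum>i<n. (\<Sum>j<m. cnj (A $$ (j, i)) * vec_index w j) * cnj (vec_index v i))"
    using A' w v A'_index by (simp add: scalar_prod_def lessThan_atLeast0)
  also have "\<dots> = (\<Sum>i<n. \<Sum>j<m. vec_index w j * cnj (A $$ (j, i) * vec_index v i))"
    by (simp add: sum_distrib_left mult_ac)
  also have "\<dots> = (\<Sum>j<m. \<Sum>i<n. vec_index w j * cnj (A $$ (j, i) * vec_index v i))"
    by (rule sum.swap)
  also have "\<dots> = (\<Sum>j<m. vec_index w j * cnj (vec_index w j))"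
    by (simp add: w_index sum_distrib_left)
  also have "\<dots> = w \<bullet>c w"
    using w by (simp add: scalar_prod_def lessThan_atLeast0)
  finally have eq: "k * (v \<bullet>c v) = w \<bullet>c w" .
  define a where "a = (\<Sum>i<dim_vec v. (cmod (vec_index v i))\<^sup>2)"
  define b where "b = (\<Sum>i<dim_vec w. (cmod (vec_index w i))\<^sup>2)"
  have vv: "v \<bullet>c v = of_real a" and ww: "w \<bullet>c w = of_real b"
    unfolding a_def b_def by (rule sq)+
  have "v \<bullet>c v \<noteq> 0" using v by simp
  hence "a \<noteq> 0" using vv by auto
  moreover have "0 \<le> a" "0 \<le> b" unfolding a_def b_def by (simp_all add: sum_nonneg)
  ultimately have "k = of_real (b / a)" "0 \<le> b / a"
    using eq unfolding vv ww by (simp_all add: field_simps)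
  hence "sqrt (b / a) \<in> singular_values A"
    using k unfolding singular_values_def by (simp flip: of_real_power)
  thus ?thesis by blast
qed

end

theory Submission
  imports Defs "HOL-Analysis.Complex_Transcendental"
begin

text \<open>
  Write \<open>v\<^sub>j\<close> for the \<open>j\<close>-th block of a vector \<open>v\<close> and \<open>Q\<^sub>j\<close> for the trigonometric polynomial with
  coefficients \<open>v\<^sub>j\<close>. The \<open>i\<close>-th block of \<open>M v\<close> consists of Fourier coefficients of
  \<open>\<Sum>j. f\<^sub>i\<^sub>j Q\<^sub>j\<close>, so Bessel's inequality bounds \<open>\<bar>M v\<bar>\<^sup>2\<close> by the mean of \<open>\<Sum>i. \<bar>\<Sum>j. f\<^sub>i\<^sub>j Q\<^sub>j\<bar>\<^sup>2\<close>. By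
  Cauchy-Schwarz the integrand is at most \<open>(\<Sum>j. \<Sum>i. \<bar>f\<^sub>i\<^sub>j\<bar>\<^sup>2) (\<Sum>j. \<bar>Q\<^sub>j\<bar>\<^sup>2)\<close>, and Parseval's identity turns the
  mean of the second factor into \<open>\<bar>v\<bar>\<^sup>2\<close>. Only
  orthogonality of characters whose frequencies differ by less than \<open>2 n\<close> is used, so the mean over the
  torus can be taken throughout to be the mean over a grid of \<open>2 n \<times> 2 n\<close> equidistant points.
\<close>

section \<open>Block-wise summation and a criterion for the largest singular value\<close>

text \<open>The range is cut into \<open>m\<close> consecutive intervals of length \<open>k\<close>,
  and each is shifted to start at \<open>0\<close>. This passes from a flat index to the pair of
  block number and position in the block.\<close>

lemma sum_lessThan_mult:
  fixes g :: "nat \<Rightarrow> nat \<Rightarrow> 'a::comm_monoid_add"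
  shows "(\<Sum>r<m * k. g (r div k) (r mod k)) = (\<Sum>i<m. \<Sum>p<k. g i p)"
proof -
  have "(\<Sum>r<m * k. g (r div k) (r mod k)) =
      (\<Sum>i<m. \<Sum>r = i * k..<i * k + k. g (r div k) (r mod k))"
    by (rule sum.nat_group [symmetric])
  also have "\<dots> = (\<Sum>i<m. \<Sum>p<k. g i p)"
  proof (rule sum.cong [OF refl])
    fix i
    have "(\<Sum>r = i * k..<i * k + k. g (r div k) (r mod k)) =
        (\<Sum>p = 0..<k. g ((p + i * k) div k) ((p + i * k) mod k))"
      using sum.shift_bounds_nat_ivl [of "\<lambda>r. g (r div k) (r mod k)" 0 "i * k" k]
      by (simp add: add.commute)
    then show "(\<Sum>r = i * k..<i * k + k. g (r div k) (r mod k)) = (\<Sum>p<k. g i p)"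
      by (simp add: lessThan_atLeast0)
  qed
  finally show ?thesis .
qed

text \<open>If \<open>v\<close> is an eigenvector of \<open>mat_adjoint A * A\<close> for
  \<open>s\<^sup>2\<close>, then s^2 |v|^2 is the inner product of that matrix applied to
  \<open>v\<close> with \<open>v\<close>, that is |A v|^2. So the bound gives s^2 \<le> c for each
  singular value. Since \<open>0 < k\<close>, the maximum is over a nonempty set.\<close>

lemma largest_singular_value_le:
  assumes A: "A \<in> carrier_mat m k" and k: "0 < k"
    and bound: "\<And>v. v \<in> carrier_vec k \<Longrightarrow>
      (\<Sum>r<m. (cmod (vec_index (A *\<^sub>v v) r))\<^sup>2) \<le> c * (\<Sum>s<k. (cmod (vec_index v s))\<^sup>2)"
  shows "largest_singular_value A \<le> sqrt c"
proof -
  have le: "s \<le> sqrt c" if s: "s \<in> singular_values A" for s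
  proof -
    have A': "mat_adjoint A \<in> carrier_mat k m"
      using A unfolding mat_adjoint_def by auto
    have A'_index: "mat_adjoint A $$ (i, j) = cnj (A $$ (j, i))" if "i < k" "j < m" for i j
      using that A unfolding mat_adjoint_def by (simp add: mat_of_rows_def conjugate_vec_def)
    have B: "mat_adjoint A * A \<in> carrier_mat k k" using A A' by auto
    obtain v where v: "v \<in> carrier_vec k" "v \<noteq> 0\<^sub>v k"
        "(mat_adjoint A * A) *\<^sub>v v = of_real (s\<^sup>2) \<cdot>\<^sub>v v"
      using s B unfolding singular_values_def eigenvalue_def eigenvector_def by auto
    define w where "w = A *\<^sub>v v"
    have w: "w \<in> carrier_vec m" using A v by (auto simp: w_def)
    have sq: "x \<bullet>c x = of_real (\<Sum>i<dim_vec x. (cmod (vec_index x i))\<^sup>2)" for x :: "complex vec"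
      by (simp add: scalar_prod_def lessThan_atLeast0 complex_norm_square del: of_real_power)
    have w_index: "vec_index w j = (\<Sum>i<k. A $$ (j, i) * vec_index v i)" if "j < m" for j
      using that A v unfolding w_def by (simp add: scalar_prod_def lessThan_atLeast0)
    have "of_real (s\<^sup>2) * (v \<bullet>c v) = ((mat_adjoint A * A) *\<^sub>v v) \<bullet>c v"
      using v by simp
    also have "\<dots> = (mat_adjoint A *\<^sub>v w) \<bullet>c v"
      using A A' v unfolding w_def by (simp add: assoc_mult_mat_vec)
    also have "\<dots> = (\<Sum>i<k. (\<Sum>j<m. cnj (A $$ (j, i)) * vec_index w j) * cnj (vec_index v i))"
      using A' w v A'_index by (simp add: scalar_prod_def lessThan_atLeast0)
    also have "\<dots> = (\<Sum>j<m. \<Sum>i<k. vec_index w j * cnj (A $$ (j, i) * vec_index v i))"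
      by (simp add: sum_distrib_left mult_ac sum.swap [of _ "{..<k}"])
    also have "\<dots> = w \<bullet>c w"
      using w by (simp add: w_index sum_distrib_left scalar_prod_def lessThan_atLeast0)
    finally have "s\<^sup>2 * (\<Sum>i<k. (cmod (vec_index v i))\<^sup>2) = (\<Sum>j<m. (cmod (vec_index w j))\<^sup>2)"
      using v w unfolding sq by (simp del: of_real_power of_real_sum of_real_mult flip: of_real_mult)
    then have le: "s\<^sup>2 * (\<Sum>i<k. (cmod (vec_index v i))\<^sup>2) \<le> c * (\<Sum>i<k. (cmod (vec_index v i))\<^sup>2)"
      using bound [OF v(1)] by (simp add: w_def)
    have "v \<bullet>c v \<noteq> 0" using v by simp
    then have "(\<Sum>i<k. (cmod (vec_index v i))\<^sup>2) \<noteq> 0"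
      using v(1) unfolding sq by (simp del: of_real_sum of_real_power)
    then have "0 < (\<Sum>i<k. (cmod (vec_index v i))\<^sup>2)"
      by (simp add: sum_nonneg order_less_le)
    with le have "s\<^sup>2 \<le> c" by simp
    then show ?thesis by (rule real_le_rsqrt)
  qed
  have "singular_values A \<noteq> {}" using A k by (intro singular_values_nonempty) auto
  then show ?thesis
    using le finite_singular_values unfolding largest_singular_value_def by simp
qed

section \<open>Finite orthogonal families: Parseval, Bessel and compressions of multiplication
  operators\<close>

text \<open>In the application \<open>e p\<close> is a character sampled at the points of a grid
  \<open>W\<close>, and \<open>c\<close> is the number of these points, which is the common squared
  norm of the sampled characters.\<close>

context
  fixes W :: "'w set" and P :: "'p set" and e :: "'p \<Rightarrow> 'w \<Rightarrow> complex" and c :: real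
  assumes c: "0 < c" and finP: "finite P"
    and orth: "\<And>p q. p \<in> P \<Longrightarrow> q \<in> P \<Longrightarrow>
      (\<Sum>w\<in>W. e p w * cnj (e q w)) = (if p = q then of_real c else 0)"
begin

text \<open>Expanding the squared modulus gives a double sum over \<open>p\<close> and
  \<open>q\<close>, of which orthogonality leaves the diagonal.\<close>

lemma parseval_orthogonal:
  "(\<Sum>w\<in>W. (cmod (\<Sum>p\<in>P. x p * e p w))\<^sup>2) = c * (\<Sum>p\<in>P. (cmod (x p))\<^sup>2)"
proof -
  have "complex_of_real (\<Sum>w\<in>W. (cmod (\<Sum>p\<in>P. x p * e p w))\<^sup>2) =
      (\<Sum>w\<in>W. \<Sum>p\<in>P. \<Sum>q\<in>P. x p * cnj (x q) * (e p w * cnj (e q w)))"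
    unfolding of_real_sum complex_norm_square
    by (simp add: sum_product mult_ac)
  also have "\<dots> = (\<Sum>p\<in>P. \<Sum>w\<in>W. \<Sum>q\<in>P. x p * cnj (x q) * (e p w * cnj (e q w)))"
    by (rule sum.swap)
  also have "\<dots> = (\<Sum>p\<in>P. \<Sum>q\<in>P. \<Sum>w\<in>W. x p * cnj (x q) * (e p w * cnj (e q w)))"
    by (rule sum.cong [OF refl], rule sum.swap)
  also have "\<dots> = (\<Sum>p\<in>P. \<Sum>q\<in>P. x p * cnj (x q) * (if p = q then of_real c else 0))"
    by (simp add: orth flip: sum_distrib_left)
  also have "\<dots> = (\<Sum>p\<in>P. x p * cnj (x p) * of_real c)"
    using finP by (simp add: if_distrib cong: if_cong)
  also have "\<dots> = complex_of_real (c * (\<Sum>p\<in>P. (cmod (x p))\<^sup>2))"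
    by (simp add: sum_distrib_left complex_norm_square mult_ac del: of_real_power)
  finally show ?thesis by (simp only: of_real_eq_iff)
qed

lemma bessel_orthogonal:
  "(\<Sum>p\<in>P. (cmod (\<Sum>w\<in>W. g w * cnj (e p w)))\<^sup>2) \<le> c * (\<Sum>w\<in>W. (cmod (g w))\<^sup>2)"
proof -
  define x where "x p = (\<Sum>w\<in>W. g w * cnj (e p w))" for p
  define Q where "Q w = (\<Sum>p\<in>P. x p * e p w)" for w
  define X where "X = (\<Sum>p\<in>P. (cmod (x p))\<^sup>2)"
  have "(\<Sum>w\<in>W. g w * cnj (Q w)) = (\<Sum>w\<in>W. \<Sum>p\<in>P. cnj (x p) * (g w * cnj (e p w)))"
    by (simp add: Q_def sum_distrib_left mult_ac)
  also have "\<dots> = (\<Sum>p\<in>P. cnj (x p) * (\<Sum>w\<in>W. g w * cnj (e p w)))"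
    by (subst sum.swap) (simp add: sum_distrib_left)
  also have "\<dots> = of_real X"
    by (simp add: X_def complex_norm_square mult_ac flip: x_def del: of_real_power)
  finally have gQ: "(\<Sum>w\<in>W. Re (g w * cnj (Q w))) = X"
    by (metis Re_complex_of_real Re_sum)
  have QQ: "(\<Sum>w\<in>W. (cmod (Q w))\<^sup>2) = c * X"
    unfolding Q_def X_def by (rule parseval_orthogonal)
  \<comment> \<open>This is |c a - b|^2 \<ge> 0. The weight \<open>c\<close> is chosen because
    \<open>Q\<close> divided by \<open>c\<close> is the orthogonal projection of \<open>g\<close> to
    the span of the family. Summed over \<open>W\<close>, it reads 2 c X \<le> c^2 |g|^2 + c
    X.\<close>
  have pt: "2 * c * Re (a * cnj b) \<le> c\<^sup>2 * (cmod a)\<^sup>2 + (cmod b)\<^sup>2" for a b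
  proof -
    have "0 \<le> (c * Re a - Re b)\<^sup>2 + (c * Im a - Im b)\<^sup>2" by simp
    then show ?thesis
      unfolding cmod_power2 by (simp add: power2_eq_square algebra_simps)
  qed
  have "2 * c * X = (\<Sum>w\<in>W. 2 * c * Re (g w * cnj (Q w)))"
    by (simp only: gQ flip: sum_distrib_left)
  also have "\<dots> \<le> (\<Sum>w\<in>W. c\<^sup>2 * (cmod (g w))\<^sup>2 + (cmod (Q w))\<^sup>2)"
    by (intro sum_mono pt)
  also have "\<dots> = c * (c * (\<Sum>w\<in>W. (cmod (g w))\<^sup>2) + X)"
    by (simp add: sum.distrib QQ power2_eq_square [of c] distrib_left mult.assoc flip: sum_distrib_left)
  finally have "c * (2 * X) \<le> c * (c * (\<Sum>w\<in>W. (cmod (g w))\<^sup>2) + X)" by (simp add: mult_ac)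
  then have "X \<le> c * (\<Sum>w\<in>W. (cmod (g w))\<^sup>2)" using c by simp
  then show ?thesis by (simp add: X_def x_def)
qed

text \<open>Toeplitz structure in abstract form: \<open>A i j\<close> is the matrix, with respect to
  the family \<open>e\<close>, of multiplication by \<open>f i j\<close> followed by projection to
  the span.\<close>

lemma block_compression_bound:
  fixes f :: "'i \<Rightarrow> 'j \<Rightarrow> 'w \<Rightarrow> complex"
  assumes A: "\<And>i j p q. i \<in> I \<Longrightarrow> j \<in> J \<Longrightarrow> p \<in> P \<Longrightarrow> q \<in> P \<Longrightarrow>
      (\<Sum>w\<in>W. f i j w * e q w * cnj (e p w)) = of_real c * A i j p q"
    and S: "\<And>w. w \<in> W \<Longrightarrow> (\<Sum>j\<in>J. \<Sum>i\<in>I. (cmod (f i j w))\<^sup>2) \<le> S"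
  shows "(\<Sum>i\<in>I. \<Sum>p\<in>P. (cmod (\<Sum>j\<in>J. \<Sum>q\<in>P. A i j p q * v j q))\<^sup>2)
    \<le> S * (\<Sum>j\<in>J. \<Sum>q\<in>P. (cmod (v j q))\<^sup>2)"
proof -
  define Q where "Q j w = (\<Sum>q\<in>P. v j q * e q w)" for j w
  define y where "y i p = (\<Sum>j\<in>J. \<Sum>q\<in>P. A i j p q * v j q)" for i p
  define g where "g i w = (\<Sum>j\<in>J. f i j w * Q j w)" for i w
  have coeff: "(\<Sum>w\<in>W. g i w * cnj (e p w)) = of_real c * y i p" if "i \<in> I" "p \<in> P" for i p
  proof -
    have "(\<Sum>w\<in>W. g i w * cnj (e p w)) =
        (\<Sum>w\<in>W. \<Sum>j\<in>J. \<Sum>q\<in>P. v j q * (f i j w * e q w * cnj (e p w)))"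
      by (simp add: g_def Q_def sum_distrib_left sum_distrib_right mult_ac)
    also have "\<dots> = (\<Sum>j\<in>J. \<Sum>w\<in>W. \<Sum>q\<in>P. v j q * (f i j w * e q w * cnj (e p w)))"
      by (rule sum.swap)
    also have "\<dots> = (\<Sum>j\<in>J. \<Sum>q\<in>P. \<Sum>w\<in>W. v j q * (f i j w * e q w * cnj (e p w)))"
      by (rule sum.cong [OF refl], rule sum.swap)
    also have "\<dots> = (\<Sum>j\<in>J. \<Sum>q\<in>P. v j q * (of_real c * A i j p q))"
      using that by (simp add: A flip: sum_distrib_left)
    finally show ?thesis by (simp add: y_def sum_distrib_left mult_ac)
  qed
  have pt: "(\<Sum>i\<in>I. (cmod (g i w))\<^sup>2) \<le> S * (\<Sum>j\<in>J. (cmod (Q j w))\<^sup>2)" if "w \<in> W" for w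
  proof -
    have "(cmod (g i w))\<^sup>2 \<le> (\<Sum>j\<in>J. (cmod (f i j w))\<^sup>2) * (\<Sum>j\<in>J. (cmod (Q j w))\<^sup>2)" for i
    proof -
      have "cmod (g i w) \<le> (\<Sum>j\<in>J. cmod (f i j w) * cmod (Q j w))"
        unfolding g_def by (rule order_trans [OF norm_sum]) (simp add: norm_mult)
      then have "(cmod (g i w))\<^sup>2 \<le> (\<Sum>j\<in>J. cmod (f i j w) * cmod (Q j w))\<^sup>2"
        by (simp add: power_mono)
      also have "\<dots> \<le> (\<Sum>j\<in>J. (cmod (f i j w))\<^sup>2) * (\<Sum>j\<in>J. (cmod (Q j w))\<^sup>2)"
        by (rule Cauchy_Schwarz_ineq_sum)
      finally show ?thesis .
    qed
    \<comment> \<open>The factor formed from the \<open>Q j\<close> does not depend on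
      \<open>i\<close>, so summing over \<open>i\<close> only affects the factor that
      \<open>S\<close> controls.\<close>
    then have "(\<Sum>i\<in>I. (cmod (g i w))\<^sup>2) \<le>
        (\<Sum>i\<in>I. \<Sum>j\<in>J. (cmod (f i j w))\<^sup>2) * (\<Sum>j\<in>J. (cmod (Q j w))\<^sup>2)"
      by (simp add: sum_mono sum_distrib_right [of _ I])
    also have "\<dots> \<le> S * (\<Sum>j\<in>J. (cmod (Q j w))\<^sup>2)"
      using S [OF that] by (intro mult_right_mono sum_nonneg) (simp_all add: sum.swap [of _ I])
    finally show ?thesis .
  qed
  \<comment> \<open>The inner products of \<open>g i\<close> with the family are \<open>c\<close>
    times \<open>y i\<close>, whence the square on the left. On the right one factor
    \<open>c\<close> comes from Bessel and one from Parseval, so they cancel.\<close>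
  have "c\<^sup>2 * (\<Sum>i\<in>I. \<Sum>p\<in>P. (cmod (y i p))\<^sup>2) =
      (\<Sum>i\<in>I. \<Sum>p\<in>P. (cmod (\<Sum>w\<in>W. g i w * cnj (e p w)))\<^sup>2)"
    by (simp add: coeff norm_mult power_mult_distrib sum_distrib_left)
  also have "\<dots> \<le> (\<Sum>i\<in>I. c * (\<Sum>w\<in>W. (cmod (g i w))\<^sup>2))"
    by (intro sum_mono bessel_orthogonal)
  also have "\<dots> = c * (\<Sum>w\<in>W. \<Sum>i\<in>I. (cmod (g i w))\<^sup>2)"
    by (simp add: sum.swap [of _ W] flip: sum_distrib_left)
  also have "\<dots> \<le> c * (\<Sum>w\<in>W. S * (\<Sum>j\<in>J. (cmod (Q j w))\<^sup>2))"
    using c by (intro mult_left_mono sum_mono pt) auto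
  also have "\<dots> = c * (S * (\<Sum>j\<in>J. \<Sum>w\<in>W. (cmod (Q j w))\<^sup>2))"
    by (simp add: sum.swap [of _ W] flip: sum_distrib_left)
  also have "\<dots> = c\<^sup>2 * (S * (\<Sum>j\<in>J. \<Sum>q\<in>P. (cmod (v j q))\<^sup>2))"
    unfolding Q_def parseval_orthogonal
    by (simp add: power2_eq_square mult_ac flip: sum_distrib_left)
  finally show ?thesis using c by (simp add: y_def)
qed

end

section \<open>Orthogonality of characters on a finite grid\<close>

text \<open>A geometric sum whose ratio \<open>z\<close> satisfies z^N = 1. It vanishes unless z =
  1, which would make \<open>h\<close> a multiple of \<open>N\<close>; in the given range only
  \<open>0\<close> is one.\<close>

lemma sum_roots_of_unity:
  assumes "\<bar>h\<bar> < int N"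
  shows "(\<Sum>a<N. exp (\<i> * of_real (of_int h * (2 * pi * real a / real N)))) =
    (if h = 0 then of_nat N else 0)"
proof (cases "h = 0")
  case False
  have N: "N > 0" using assms by auto
  define z where "z = exp (\<i> * of_real (of_int h * (2 * pi / real N)))"
  have pow: "exp (\<i> * of_real (of_int h * (2 * pi * real a / real N))) = z ^ a" for a
    unfolding z_def exp_of_nat_mult [symmetric] by (simp add: mult_ac)
  have "z ^ N = exp (of_int h * (2 * pi * \<i>))"
    using N by (simp add: mult_ac flip: pow)
  also have "\<dots> = 1" by (auto simp: exp_eq_1)
  finally have zN: "z ^ N = 1" .
  have "z \<noteq> 1"
  proof
    assume "z = 1"
    then obtain k :: int where "of_int h * (2 * pi / real N) = of_int (2 * k) * pi"
      unfolding z_def exp_eq_1 by auto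
    then have "real_of_int h = of_int (k * int N)"
      using N by (simp add: field_simps)
    then have "h = k * int N" by (simp only: of_int_eq_iff)
    with assms False show False
      by (simp add: abs_mult)
  qed
  then have "(\<Sum>a<N. z ^ a) = 0"
    by (simp add: geometric_sum zN)
  with False show ?thesis unfolding pow by simp
qed simp

definition torus_char :: "int \<Rightarrow> int \<Rightarrow> real \<Rightarrow> real \<Rightarrow> complex" where
  "torus_char h1 h2 \<omega>1 \<omega>2 = exp (\<i> * of_real (of_int h1 * \<omega>1 + of_int h2 * \<omega>2))"

lemma torus_char_mult:
  "torus_char h1 h2 \<omega>1 \<omega>2 * torus_char k1 k2 \<omega>1 \<omega>2 = torus_char (h1 + k1) (h2 + k2) \<omega>1 \<omega>2"
  by (simp add: torus_char_def algebra_simps flip: exp_add)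

lemma torus_char_cnj: "cnj (torus_char h1 h2 \<omega>1 \<omega>2) = torus_char (- h1) (- h2) \<omega>1 \<omega>2"
  by (simp add: torus_char_def exp_cnj algebra_simps)

lemma cmod_torus_char [simp]: "cmod (torus_char h1 h2 \<omega>1 \<omega>2) = 1"
  unfolding torus_char_def by (rule norm_exp_i_times)

text \<open>The character is a product of a function of each variable, so the sum over the grid is a
  product of two sums over roots of unity.\<close>

lemma sum_torus_char_grid:
  assumes "\<bar>h1\<bar> < int N" and "\<bar>h2\<bar> < int N"
  shows "(\<Sum>(a, b)\<in>{..<N} \<times> {..<N}. torus_char h1 h2 (2 * pi * real a / real N) (2 * pi * real b / real N)) =
    (if h1 = 0 \<and> h2 = 0 then of_real ((real N)\<^sup>2) else 0)"
proof -
  have "(\<Sum>(a, b)\<in>{..<N} \<times> {..<N}. torus_char h1 h2 (2 * pi * real a / real N) (2 * pi * real b / real N)) =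
    (\<Sum>a<N. exp (\<i> * of_real (of_int h1 * (2 * pi * real a / real N)))) *
    (\<Sum>b<N. exp (\<i> * of_real (of_int h2 * (2 * pi * real b / real N))))"
    unfolding sum_product sum.cartesian_product torus_char_def
    by (simp only: of_real_add distrib_left exp_add)
  also have "\<dots> = (if h1 = 0 \<and> h2 = 0 then of_real ((real N)\<^sup>2) else 0)"
    unfolding sum_roots_of_unity [OF assms(1)] sum_roots_of_unity [OF assms(2)]
    by (simp add: power2_eq_square)
  finally show ?thesis .
qed

section \<open>Fourier coefficients of trigonometric polynomials, by integrals and by grid
  sums\<close>

text \<open>The frequencies are exactly the differences of two indices from \<open>0\<close> to
  \<open>n - 1\<close>, as they occur in the Toeplitz blocks.\<close>

definition trig_poly :: "nat \<Rightarrow> (int \<Rightarrow> int \<Rightarrow> real) \<Rightarrow> real \<Rightarrow> real \<Rightarrow> complex" where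
  "trig_poly n d \<omega>1 \<omega>2 = (\<Sum>h1 = - int n + 1..int n - 1. \<Sum>h2 = - int n + 1..int n - 1.
    of_real (d h1 h2) * torus_char h1 h2 \<omega>1 \<omega>2)"

text \<open>Provides the upper bound that makes the supremum over the torus dominate each
  value.\<close>

lemma cmod_trig_poly_le:
  "cmod (trig_poly n d \<omega>1 \<omega>2) \<le>
    (\<Sum>h1 = - int n + 1..int n - 1. \<Sum>h2 = - int n + 1..int n - 1. \<bar>d h1 h2\<bar>)"
  unfolding trig_poly_def by (intro sum_norm_le) (simp add: norm_mult)

text \<open>For nonzero \<open>m\<close> the antiderivative \<open>F\<close> takes equal values at
  both ends of the period.\<close>

lemma has_integral_exp_int:
  "((\<lambda>x. exp (\<i> * of_real (of_int m * x))) has_integral (if m = 0 then 2 * of_real pi else 0))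
    {0..2 * pi}"
proof (cases "m = 0")
  case True
  then show ?thesis
    using has_integral_const_real [of "1 :: complex" 0 "2 * pi"]
    by (simp add: scaleR_conv_of_real)
next
  case False
  define F where "F x = exp (\<i> * of_real (of_int m * x)) / (\<i> * of_int m)" for x :: real
  have "((\<lambda>x. exp (\<i> * of_real (of_int m * x))) has_integral F (2 * pi) - F 0) {0..2 * pi}"
  proof (rule fundamental_theorem_of_calculus)
    fix x :: real
    show "(F has_vector_derivative exp (\<i> * of_real (of_int m * x))) (at x within {0..2 * pi})"
      unfolding F_def using False
      by (auto intro!: derivative_eq_intros has_vector_derivative_real_field simp: field_simps)
  qed simp
  moreover have "exp (\<i> * of_real (of_int m * (2 * pi))) = 1"
    by (auto simp: exp_eq_1)
  then have "F (2 * pi) - F 0 = 0" by (simp add: F_def)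
  ultimately show ?thesis using False by simp
qed

text \<open>Termwise integration leaves only the frequency \<open>(k1, k2)\<close>, which lies in
  the range of summation by the assumptions. The two integrals contribute 4 pi^2, which cancels the
  normalisation.\<close>

lemma fourier_coeff_trig_poly:
  assumes "\<bar>k1\<bar> < int n" and "\<bar>k2\<bar> < int n"
  shows "fourier_coeff (trig_poly n d) k1 k2 = of_real (d k1 k2)"
proof -
  let ?H = "{- int n + 1..int n - 1}"
  have k: "k1 \<in> ?H" "k2 \<in> ?H" using assms by auto
  let ?E = "\<lambda>m x. exp (\<i> * complex_of_real (of_int m * x))"
  let ?D = "\<lambda>m. if m = 0 then 2 * complex_of_real pi else 0"
  \<comment> \<open>The factor depending on \<open>\<omega>1\<close> stands last, so that everything
    before it is a constant for the inner integral.\<close>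
  have expand: "exp (- (\<i> * of_real (of_int k1 * \<omega>1 + of_int k2 * \<omega>2))) * trig_poly n d \<omega>1 \<omega>2 =
      (\<Sum>h1\<in>?H. \<Sum>h2\<in>?H. (of_real (d h1 h2) * ?E (h2 - k2) \<omega>2) * ?E (h1 - k1) \<omega>1)" for \<omega>1 \<omega>2
    unfolding trig_poly_def torus_char_def sum_distrib_left
    by (intro sum.cong refl) (simp add: algebra_simps exp_diff exp_add exp_minus divide_simps)
  have inner: "integral {0..2 * pi} (\<lambda>\<omega>1.
        exp (- (\<i> * of_real (of_int k1 * \<omega>1 + of_int k2 * \<omega>2))) * trig_poly n d \<omega>1 \<omega>2) =
      (\<Sum>h1\<in>?H. \<Sum>h2\<in>?H. (of_real (d h1 h2) * ?D (h1 - k1)) * ?E (h2 - k2) \<omega>2)" for \<omega>2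
  proof -
    have "((\<lambda>\<omega>1. \<Sum>h1\<in>?H. \<Sum>h2\<in>?H. (of_real (d h1 h2) * ?E (h2 - k2) \<omega>2) * ?E (h1 - k1) \<omega>1)
        has_integral (\<Sum>h1\<in>?H. \<Sum>h2\<in>?H. (of_real (d h1 h2) * ?E (h2 - k2) \<omega>2) * ?D (h1 - k1)))
        {0..2 * pi}"
      by (intro has_integral_sum has_integral_mult_right has_integral_exp_int finite_atLeastAtMost_int)
    then show ?thesis
      unfolding expand by (subst integral_unique) (auto simp: mult_ac)
  qed
  have "((\<lambda>\<omega>2. \<Sum>h1\<in>?H. \<Sum>h2\<in>?H. (of_real (d h1 h2) * ?D (h1 - k1)) * ?E (h2 - k2) \<omega>2)
      has_integral (\<Sum>h1\<in>?H. \<Sum>h2\<in>?H. (of_real (d h1 h2) * ?D (h1 - k1)) * ?D (h2 - k2))) {0..2 * pi}"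
    by (intro has_integral_sum has_integral_mult_right has_integral_exp_int finite_atLeastAtMost_int)
  then have "fourier_coeff (trig_poly n d) k1 k2 = 1 / (4 * of_real pi ^ 2) *
      (\<Sum>h1\<in>?H. \<Sum>h2\<in>?H. (of_real (d h1 h2) * ?D (h1 - k1)) * ?D (h2 - k2))"
    unfolding fourier_coeff_def inner by (simp only: integral_unique)
  \<comment> \<open>The test on \<open>h2\<close>, the inner summation variable, is placed outermost
    so that the two sums collapse one after the other.\<close>
  also have "(\<Sum>h1\<in>?H. \<Sum>h2\<in>?H. (of_real (d h1 h2) * ?D (h1 - k1)) * ?D (h2 - k2)) =
      (\<Sum>h1\<in>?H. \<Sum>h2\<in>?H. if h2 = k2 then (if h1 = k1 then of_real (d h1 h2) * (4 * of_real pi ^ 2) else 0) else 0)"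
    by (intro sum.cong refl) (simp add: power2_eq_square)
  also have "\<dots> = of_real (d k1 k2) * (4 * of_real pi ^ 2)"
    using k by simp
  finally show ?thesis by simp
qed

text \<open>Sampling recovers the exact coefficient: the frequencies \<open>h1 - k1\<close> and
  \<open>h2 - k2\<close> have modulus at most 2 n - 2, which is less than \<open>N\<close>, so no
  aliasing occurs.\<close>

lemma sum_grid_trig_poly:
  assumes "\<bar>k1\<bar> < int n" and "\<bar>k2\<bar> < int n" and N: "N = 2 * n"
  shows "(\<Sum>(a, b)\<in>{..<N} \<times> {..<N}.
      trig_poly n d (2 * pi * real a / real N) (2 * pi * real b / real N) *
      torus_char (- k1) (- k2) (2 * pi * real a / real N) (2 * pi * real b / real N)) =
    of_real ((real N)\<^sup>2) * of_real (d k1 k2)"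
proof -
  let ?H = "{- int n + 1..int n - 1}"
  have k: "k1 \<in> ?H" "k2 \<in> ?H" using assms by auto
  let ?t = "\<lambda>a::nat. 2 * pi * real a / real N"
  let ?W = "{..<N} \<times> {..<N}"
  have "(\<Sum>(a, b)\<in>?W. trig_poly n d (?t a) (?t b) * torus_char (- k1) (- k2) (?t a) (?t b)) =
      (\<Sum>w\<in>?W. \<Sum>h1\<in>?H. \<Sum>h2\<in>?H.
        of_real (d h1 h2) * (case w of (a, b) \<Rightarrow> torus_char (h1 - k1) (h2 - k2) (?t a) (?t b)))"
    by (intro sum.cong refl)
      (auto simp: trig_poly_def sum_distrib_right mult.assoc torus_char_mult)
  also have "\<dots> = (\<Sum>h1\<in>?H. \<Sum>w\<in>?W. \<Sum>h2\<in>?H.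
        of_real (d h1 h2) * (case w of (a, b) \<Rightarrow> torus_char (h1 - k1) (h2 - k2) (?t a) (?t b)))"
    by (rule sum.swap)
  also have "\<dots> = (\<Sum>h1\<in>?H. \<Sum>h2\<in>?H. \<Sum>w\<in>?W.
        of_real (d h1 h2) * (case w of (a, b) \<Rightarrow> torus_char (h1 - k1) (h2 - k2) (?t a) (?t b)))"
    by (rule sum.cong [OF refl], rule sum.swap)
  also have "\<dots> = (\<Sum>h1\<in>?H. \<Sum>h2\<in>?H. if h2 = k2 then (if h1 = k1 then
      of_real (d h1 h2) * of_real ((real N)\<^sup>2) else 0) else 0)"
    unfolding sum_distrib_left [symmetric]
  proof (intro sum.cong refl)
    fix h1 h2 assume "h1 \<in> ?H" "h2 \<in> ?H"
    then have "\<bar>h1 - k1\<bar> < int N" "\<bar>h2 - k2\<bar> < int N" using assms by auto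
    then show "of_real (d h1 h2) *
        (\<Sum>w\<in>?W. case w of (a, b) \<Rightarrow> torus_char (h1 - k1) (h2 - k2) (?t a) (?t b)) =
      (if h2 = k2 then (if h1 = k1 then
        of_real (d h1 h2) * complex_of_real ((real N)\<^sup>2) else 0) else 0)"
      by (simp only: sum_torus_char_grid) simp
  qed
  also have "\<dots> = of_real ((real N)\<^sup>2) * of_real (d k1 k2)"
    using k by simp
  finally show ?thesis .
qed

section \<open>Index arithmetic and the entries of a doubly-block Toeplitz matrix\<close>

text \<open>Quotient and remainder are the two base \<open>n\<close> digits of an index below
  \<open>n\<^sup>2\<close>, so both lie between \<open>0\<close> and \<open>n - 1\<close>.\<close>

lemma abs_diff_div_mod_less:
  fixes n p q :: nat
  assumes "p < n\<^sup>2" and "q < n\<^sup>2"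
  shows "\<bar>int (p div n) - int (q div n)\<bar> < int n" "\<bar>int (p mod n) - int (q mod n)\<bar> < int n"
proof -
  have n: "n > 0" using assms by (cases n) auto
  have "p div n < n" "q div n < n"
    using assms by (auto simp: power2_eq_square less_mult_imp_div_less)
  then show "\<bar>int (p div n) - int (q div n)\<bar> < int n" by linarith
  have "p mod n < n" "q mod n < n" using n by auto
  then show "\<bar>int (p mod n) - int (q mod n)\<bar> < int n" by linarith
qed

lemma doubly_block_toeplitz_trig_poly:
  assumes "p < n\<^sup>2" and "q < n\<^sup>2"
  shows "doubly_block_toeplitz n (trig_poly n d) $$ (p, q) =
    of_real (d (int (p div n) - int (q div n)) (int (p mod n) - int (q mod n)))"
proof -
  have "n > 0" using assms by (cases n) auto
  moreover have "p div n < n" "q div n < n"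
    using assms by (auto simp: power2_eq_square less_mult_imp_div_less)
  ultimately show ?thesis
    using assms fourier_coeff_trig_poly [OF abs_diff_div_mod_less [OF assms]]
    by (simp add: doubly_block_toeplitz_def block_mat_def toeplitz_block_def power2_eq_square)
qed

section \<open>The norm bound for the block matrix, from the grid\<close>

theorem theorem5p5:
  fixes n c_in c_out :: nat
    and d :: "nat \<Rightarrow> nat \<Rightarrow> int \<Rightarrow> int \<Rightarrow> real"
    and f :: "nat \<Rightarrow> nat \<Rightarrow> real \<Rightarrow> real \<Rightarrow> complex"
    and M :: "complex mat"
  assumes "n \<ge> 1" and "c_in \<ge> 1" and "c_out \<ge> 1"
    and "\<And>i j \<omega>1 \<omega>2. i \<in> {1..c_in} \<Longrightarrow> j \<in> {1..c_out} \<Longrightarrow>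
      f i j \<omega>1 \<omega>2 =
        (\<Sum>h1 = - int n + 1..int n - 1. \<Sum>h2 = - int n + 1..int n - 1.
          of_real (d i j h1 h2) * exp (\<i> * of_real (of_int h1 * \<omega>1 + of_int h2 * \<omega>2)))"
    and "M = block_mat c_in c_out (n ^ 2) (n ^ 2)
      (\<lambda>i j. doubly_block_toeplitz n (f (Suc i) (Suc j)))"
  shows "elements_mat M \<subseteq> \<real> \<and>
    largest_singular_value M \<le>
      sqrt (\<Sum>j = 1..c_out. SUP (\<omega>1, \<omega>2)\<in>{0..2 * pi} \<times> {0..2 * pi}.
        \<Sum>i = 1..c_in. (cmod (f i j \<omega>1 \<omega>2))\<^sup>2)"
proof
  define m where "m = n\<^sup>2"
  \<comment> \<open>In a product of some \<open>f i j\<close>, a character and a conjugate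
    character, frequencies reach n - 1 from the polynomial plus n - 1 from the index difference,
    hence stay below 2 n.\<close>
  define N where "N = 2 * n"
  let ?t = "\<lambda>a::nat. 2 * pi * real a / real N"
  define W where "W = {..<N} \<times> {..<N}"
  define e where "e p = (\<lambda>(a, b). torus_char (int (p div n)) (int (p mod n)) (?t a) (?t b))" for p
  \<comment> \<open>Blocks are numbered from \<open>0\<close> and the given functions from
    \<open>1\<close>, hence the shift by \<open>Suc\<close>.\<close>
  define g where "g i j = (\<lambda>(a, b). f (Suc i) (Suc j) (?t a) (?t b))" for i j
  define D where "D i j p q =
    d (Suc i) (Suc j) (int (p div n) - int (q div n)) (int (p mod n) - int (q mod n))" for i j p q
  have m: "m > 0" and N: "N > 0" using \<open>n \<ge> 1\<close> by (auto simp: m_def N_def)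
  have f: "f (Suc i) (Suc j) = trig_poly n (d (Suc i) (Suc j))" if "i < c_in" "j < c_out" for i j
    using that assms(4) [of "Suc i" "Suc j"]
    by (auto simp: fun_eq_iff trig_poly_def torus_char_def)
  have dim: "M \<in> carrier_mat (c_in * m) (c_out * m)"
    unfolding assms(5) block_mat_def m_def by simp
  have entry: "M $$ (r, s) = of_real (D (r div m) (s div m) (r mod m) (s mod m))"
    if "r < c_in * m" "s < c_out * m" for r s
    using that m unfolding assms(5) block_mat_def m_def [symmetric] D_def
    by (simp add: f less_mult_imp_div_less doubly_block_toeplitz_trig_poly flip: m_def)
  show "elements_mat M \<subseteq> \<real>"
    using dim by (auto simp: elements_mat_def entry)

  have orth: "(\<Sum>w\<in>W. e p w * cnj (e q w)) = (if p = q then of_real ((real N)\<^sup>2) else 0)"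
    if "p \<in> {..<m}" "q \<in> {..<m}" for p q
  proof -
    have "(\<Sum>w\<in>W. e p w * cnj (e q w)) =
      (\<Sum>(a, b)\<in>{..<N} \<times> {..<N}. torus_char (int (p div n) - int (q div n))
        (int (p mod n) - int (q mod n)) (?t a) (?t b))"
      unfolding W_def
      by (intro sum.cong refl) (auto simp: e_def torus_char_cnj torus_char_mult)
    also have "\<dots> = (if p div n = q div n \<and> p mod n = q mod n then of_real ((real N)\<^sup>2) else 0)"
      using abs_diff_div_mod_less [of p n q] that
      by (subst sum_torus_char_grid) (auto simp: N_def m_def)
    also have "p div n = q div n \<and> p mod n = q mod n \<longleftrightarrow> p = q"
      by (metis div_mult_mod_eq)
    finally show ?thesis .
  qed
  \<comment> \<open>The product of \<open>e q\<close> and the conjugate of \<open>e p\<close> has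
    the frequency of \<open>q\<close> minus that of \<open>p\<close>, so it extracts the coefficient
    at the opposite difference, which is the entry in row \<open>p\<close> and column
    \<open>q\<close>.\<close>
  have coeff: "(\<Sum>w\<in>W. g i j w * e q w * cnj (e p w)) = of_real ((real N)\<^sup>2) * of_real (D i j p q)"
    if "i \<in> {..<c_in}" "j \<in> {..<c_out}" "p \<in> {..<m}" "q \<in> {..<m}" for i j p q
  proof -
    have "(\<Sum>w\<in>W. g i j w * e q w * cnj (e p w)) =
      (\<Sum>(a, b)\<in>{..<N} \<times> {..<N}. trig_poly n (d (Suc i) (Suc j)) (?t a) (?t b) *
        torus_char (- (int (p div n) - int (q div n))) (- (int (p mod n) - int (q mod n))) (?t a) (?t b))"
      unfolding W_def using that
      by (intro sum.cong refl) (auto simp: g_def f e_def torus_char_cnj torus_char_mult mult.assoc)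
    also have "\<dots> = of_real ((real N)\<^sup>2) * of_real (D i j p q)"
      unfolding D_def using abs_diff_div_mod_less [of p n q] that
      by (intro sum_grid_trig_poly) (auto simp: N_def m_def)
    finally show ?thesis .
  qed

  let ?F = "\<lambda>j (\<omega>1, \<omega>2). \<Sum>i = 1..c_in. (cmod (f i j \<omega>1 \<omega>2))\<^sup>2"
  let ?T = "{0..2 * pi} \<times> {0..2 * pi}"
  define S where "S = (\<Sum>j = 1..c_out. SUP w\<in>?T. ?F j w)"
  \<comment> \<open>A value is below the supremum once the set is bounded above; the bound is the
    sum over \<open>i\<close> of the squared absolute coefficient sums.\<close>
  have F_le: "?F j w \<le> (SUP w\<in>?T. ?F j w)" if "j \<in> {1..c_out}" "w \<in> ?T" for j w
  proof (rule cSUP_upper [OF that(2)], rule bdd_aboveI2)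
    fix w
    let ?B = "\<lambda>i. \<Sum>h1 = - int n + 1..int n - 1. \<Sum>h2 = - int n + 1..int n - 1. \<bar>d i j h1 h2\<bar>"
    have "cmod (f i j \<omega>1 \<omega>2) \<le> ?B i" if "i \<in> {1..c_in}" for i \<omega>1 \<omega>2
      using f [of "i - 1" "j - 1"] that \<open>j \<in> {1..c_out}\<close> cmod_trig_poly_le by auto
    then show "?F j w \<le> (\<Sum>i = 1..c_in. (?B i)\<^sup>2)"
      by (auto split: prod.split intro!: sum_mono power_mono)
  qed
  \<comment> \<open>All grid points lie in the square, so at each of them every \<open>j\<close> can
    be bounded by its own supremum.\<close>
  have S: "(\<Sum>j<c_out. \<Sum>i<c_in. (cmod (g i j w))\<^sup>2) \<le> S" if "w \<in> W" for w
  proof -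
    obtain a b where w: "w = (a, b)" "a < N" "b < N" using \<open>w \<in> W\<close> unfolding W_def by auto
    then have T: "(?t a, ?t b) \<in> ?T" by (auto simp: field_simps)
    have "(\<Sum>j<c_out. \<Sum>i<c_in. (cmod (g i j w))\<^sup>2) = (\<Sum>j = 1..c_out. ?F j (?t a, ?t b))"
      by (simp add: w g_def sum.atLeast1_atMost_eq)
    also have "\<dots> \<le> S"
      unfolding S_def by (intro sum_mono F_le T)
    finally show ?thesis .
  qed

  have "largest_singular_value M \<le> sqrt S"
  proof (rule largest_singular_value_le [OF dim])
    show "0 < c_out * m" using \<open>c_out \<ge> 1\<close> m by simp
    fix v :: "complex vec" assume v: "v \<in> carrier_vec (c_out * m)"
    define u where "u j q = vec_index v (j * m + q)" for j q
    have v_index: "vec_index v s = u (s div m) (s mod m)" for s by (simp add: u_def)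
    have Mv: "vec_index (M *\<^sub>v v) r =
        (\<Sum>j<c_out. \<Sum>q<m. of_real (D (r div m) j (r mod m) q) * u j q)" if "r < c_in * m" for r
    proof -
      have "vec_index (M *\<^sub>v v) r = (\<Sum>s<c_out * m. M $$ (r, s) * vec_index v s)"
        using dim v that by (simp add: scalar_prod_def lessThan_atLeast0)
      also have "\<dots> = (\<Sum>s<c_out * m.
          of_real (D (r div m) (s div m) (r mod m) (s mod m)) * u (s div m) (s mod m))"
        using that by (intro sum.cong refl) (simp add: entry v_index)
      also have "\<dots> = (\<Sum>j<c_out. \<Sum>q<m. of_real (D (r div m) j (r mod m) q) * u j q)"
        by (rule sum_lessThan_mult [where g = "\<lambda>j q. of_real (D (r div m) j (r mod m) q) * u j q"])
      finally show ?thesis .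
    qed
    have "(\<Sum>r<c_in * m. (cmod (vec_index (M *\<^sub>v v) r))\<^sup>2) =
        (\<Sum>i<c_in. \<Sum>p<m. (cmod (\<Sum>j<c_out. \<Sum>q<m. of_real (D i j p q) * u j q))\<^sup>2)"
      using sum_lessThan_mult [where k = m and m = c_in and
          g = "\<lambda>i p. (cmod (\<Sum>j<c_out. \<Sum>q<m. of_real (D i j p q) * u j q))\<^sup>2"]
      by (simp add: Mv)
    \<comment> \<open>The family consists of the \<open>m\<close> sampled characters; their squared
      norm is the number of grid points, \<open>N\<close> squared.\<close>
    also have "\<dots> \<le> S * (\<Sum>j<c_out. \<Sum>q<m. (cmod (u j q))\<^sup>2)"
      by (rule block_compression_bound [where c = "(real N)\<^sup>2" and W = W and e = e and f = g,
            OF _ _ orth coeff S]) (use N in auto)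
    also have "\<dots> = S * (\<Sum>s<c_out * m. (cmod (vec_index v s))\<^sup>2)"
      unfolding v_index
      using sum_lessThan_mult [where k = m and m = c_out and g = "\<lambda>j q. (cmod (u j q))\<^sup>2"] by simp
    finally show "(\<Sum>r<c_in * m. (cmod (vec_index (M *\<^sub>v v) r))\<^sup>2) \<le>
        S * (\<Sum>s<c_out * m. (cmod (vec_index v s))\<^sup>2)" .
  qed
  then show "largest_singular_value M \<le>
      sqrt (\<Sum>j = 1..c_out. SUP (\<omega>1, \<omega>2)\<in>{0..2 * pi} \<times> {0..2 * pi}.
        \<Sum>i = 1..c_in. (cmod (f i j \<omega>1 \<omega>2))\<^sup>2)"
    by (simp only: S_def)
qed

end
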